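(* Let $0<a\le b\le c\le R$ and let $\mathbb S$ be a finite nonempty labelled family of $a\times b\times c$ convex slabs in a ball $B_R\subset\mathbb R^3$ of radius $R$ (repeated geometric slabs with different labels allowed), with measurable shadings $Y(S)\subset S$. Put $$D=\Delta_{\max}(\mathbb S),\quad L=1+\lceil\log_2(R/a)\rceil,\quad A=\sum_S|Y(S)|,\quad U=\bigcup_SY(S),\quad\lambda=\frac{A}{\sum_S|S|} .$$ Then $$|U|\gtrsim\frac{\lambda^2\,|\mathbb S|\,abc}{1+LD\,R^4/(b^2c^2)} .$$ If $\lambda>0$, this is equivalently, with $\mu=A/|U|$, $$\mu\lesssim\lambda^{-1}\left(1+LD\,\frac{R^4}{b^2c^2}\right).$$ No separation or pointwise-constant multiplicity hypothesis is required.
   Context: $|\cdot|$ of a set is Lebesgue measure and $|\mathbb S|$ is labelled cardinality; all sums are over labels. $\Delta_{\max}(\mathbb S)=\sup_K|K|^{-1}\sum_{S\in\mathbb S:\,S\subset K}|S|$ over convex $K\subset\mathbb R^3$ with $0<|K|<\infty$. "$a\times b\times c$ convex slab" means that each label comes with an ordered orthonormal frame and a centred rectangular box $R_S$ with side lengths $a,b,c$ along the frame such that $c_JR_S\subset S\subset R_S$ (dilation about the centre of $R_S$), where $c_J>0$ is one fixed dimensional constant; in particular $|S|\asymp abc$. Implicit constants depend only on $c_J$. *)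

theory Defs
  imports "HOL-Analysis.Analysis"
begin

definition orthonormal_frame :: "(3 \<Rightarrow> real^3) \<Rightarrow> bool" where
  "orthonormal_frame e \<longleftrightarrow> (\<forall>i j. e i \<bullet> e j = (if i = j then 1 else 0))"

text \<open>The closed box with centre \<open>z\<close> and side lengths \<open>a\<close>, \<open>b\<close>, \<open>c\<close> along
  \<open>e 1\<close>, \<open>e 2\<close>, \<open>e 3\<close>.\<close>

definition frame_box ::
  "real^3 \<Rightarrow> (3 \<Rightarrow> real^3) \<Rightarrow> real \<Rightarrow> real \<Rightarrow> real \<Rightarrow> (real^3) set" where
  "frame_box z e a b c =
     {x. \<bar>(x - z) \<bullet> e 1\<bar> \<le> a / 2 \<and> \<bar>(x - z) \<bullet> e 2\<bar> \<le> b / 2 \<and> \<bar>(x - z) \<bullet> e 3\<bar> \<le> c / 2}"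

definition dilate :: "real^3 \<Rightarrow> real \<Rightarrow> (real^3) set \<Rightarrow> (real^3) set" where
  "dilate z r B = (\<lambda>x. z + r *\<^sub>R (x - z)) ` B"

definition convex_slab ::
  "real \<Rightarrow> real \<Rightarrow> real \<Rightarrow> real \<Rightarrow> real^3 \<Rightarrow> (3 \<Rightarrow> real^3) \<Rightarrow> (real^3) set \<Rightarrow> bool" where
  "convex_slab cJ a b c z e S \<longleftrightarrow>
     orthonormal_frame e \<and> convex S \<and>
     dilate z cJ (frame_box z e a b c) \<subseteq> S \<and> S \<subseteq> frame_box z e a b c"

text \<open>A labelled family is a map \<open>S\<close> together with a label set \<open>I\<close>; \<open>S\<close> need not be
  injective on \<open>I\<close>. For finite \<open>I\<close> and bounded convex members the supremum is over a
  nonempty set bounded above by \<open>card I\<close>, so it is a genuine real supremum.\<close>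

definition Delta_max :: "'i set \<Rightarrow> ('i \<Rightarrow> (real^3) set) \<Rightarrow> real" where
  "Delta_max I S =
     (SUP K \<in> {K. convex K \<and> K \<in> lmeasurable \<and> 0 < measure lebesgue K}.
        (\<Sum>i\<in>{i\<in>I. S i \<subseteq> K}. measure lebesgue (S i)) / measure lebesgue K)"

end

theory Submission
  imports Defs
begin

text \<open>
  Cauchy--Schwarz applied to \<open>\<Sum>\<^sub>i 1\<^bsub>Y i\<^esub>\<close>, which lives on \<open>U\<close>, gives
  \<open>A\<^sup>2 \<le> |U| \<Sum>\<^sub>i \<Sum>\<^sub>j |Y i \<inter> Y j|\<close> (\<open>sq_sum_measure_le\<close>), and the slabs may replace the
  shadings on the right. So it is enough to bound, for each fixed \<open>i\<close>, the total overlap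
  \<open>\<Sum>\<^sub>j |S i \<inter> S j|\<close> by a constant times \<open>a b c \<cdot> L D R\<^sup>4 / (b\<^sup>2 c\<^sup>2)\<close>; this is \<open>overlap_sum_le\<close>.

  Let \<open>s\<^sub>j\<close> be the sine of the angle between the short directions of \<open>S i\<close> and \<open>S j\<close>, and sort
  the \<open>j\<close> for which \<open>S j\<close> meets \<open>S i\<close> by the dyadic size \<open>s\<^sub>j \<sim> 2\<^sup>k a / R\<close>, which leaves
  \<open>L\<close> values of \<open>k\<close>. Two competing effects cancel at each scale.
  A large angle makes the intersection small: two layers of thickness \<open>a\<close> cross in a
  prism of cross section \<open>a\<^sup>2 / s\<^sub>j\<close>, so that \<open>|S i \<inter> S j|\<close> is at most of order
  \<open>a\<^sup>2 R / s\<^sub>j \<sim> a R\<^sup>2 / 2\<^sup>k\<close> (\<open>slab_overlap\<close>).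
  A small angle makes such slabs few: they all lie in the part of the ball within distance
  of order \<open>2\<^sup>k a\<close> from the middle plane of \<open>S i\<close> (\<open>slab_subset_plank\<close>), a convex set of
  volume of order \<open>R\<^sup>2 2\<^sup>k a\<close>, and the definition of \<open>D\<close> bounds their number by a multiple of
  \<open>D R\<^sup>2 2\<^sup>k a / (a b c)\<close>. The product of the two bounds does not depend on \<open>k\<close>, and summing
  it over the scales gives the factor \<open>L\<close>.
\<close>

section \<open>Volumes of boxes and crossing strips\<close>

unbundle cross3_syntax
unbundle no set_product_syntax

lemma prod_UNIV_3: "(\<Prod>i\<in>(UNIV :: 3 set). f i) = f 1 * f 2 * f 3" for f :: "3 \<Rightarrow> 'a::comm_monoid_mult"
  unfolding UNIV_3 by (simp add: ac_simps)

text \<open>The linear map \<open>x \<mapsto> (x \<bullet> u, x \<bullet> v, x \<bullet> w)\<close> has the triple product as its determinant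
  and sends \<open>E\<close> into a coordinate box. The centres may differ because a box may be translated
  in each coordinate separately. For an orthonormal frame the lemma bounds a box from above; for two
  normals and their cross product it bounds the crossing of two slabs.\<close>

lemma measure_three_strips:
  fixes u v w :: "real^3"
  assumes E: "E \<in> lmeasurable"
    and u: "\<And>x. x \<in> E \<Longrightarrow> \<bar>(x - p) \<bullet> u\<bar> \<le> \<alpha>"
    and v: "\<And>x. x \<in> E \<Longrightarrow> \<bar>(x - q) \<bullet> v\<bar> \<le> \<beta>"
    and w: "\<And>x. x \<in> E \<Longrightarrow> \<bar>(x - r) \<bullet> w\<bar> \<le> \<gamma>"
    and nonneg: "0 \<le> \<alpha>" "0 \<le> \<beta>" "0 \<le> \<gamma>"
  shows "\<bar>u \<bullet> (v \<times> w)\<bar> * measure lebesgue E \<le> 8 * \<alpha> * \<beta> * \<gamma>"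
proof -
  define M :: "real^3^3" where "M = vector [u, v, w]"
  define m :: "real^3" where "m = vector [p \<bullet> u, q \<bullet> v, r \<bullet> w]"
  define h :: "real^3" where "h = vector [\<alpha>, \<beta>, \<gamma>]"
  let ?B = "cbox (m - h) (m + h)"
  have comp: "(M *v x) $ 1 = x \<bullet> u" "(M *v x) $ 2 = x \<bullet> v" "(M *v x) $ 3 = x \<bullet> w" for x
    by (simp_all add: M_def matrix_vector_mult_def inner_vec_def sum_3 mult.commute)
  have sub: "(*v) M ` E \<subseteq> ?B"
  proof clarify
    fix x assume "x \<in> E"
    then show "M *v x \<in> ?B"
      using u[of x] v[of x] w[of x]
      by (simp add: mem_box_cart forall_3 comp m_def h_def inner_diff_left abs_le_iff algebra_simps)
  qed
  have "\<bar>u \<bullet> (v \<times> w)\<bar> * measure lebesgue E = measure lebesgue ((*v) M ` E)"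
    using measure_linear_image[OF matrix_vector_mul_linear[of M] E]
    by (simp add: dot_cross_det M_def)
  also have "\<dots> \<le> measure lebesgue ?B"
    by (rule measure_mono_fmeasurable[OF sub])
       (auto intro: fmeasurableD measurable_linear_image E)
  also have "\<dots> = 8 * \<alpha> * \<beta> * \<gamma>"
  proof -
    have "m \<in> ?B"
      using nonneg by (simp add: mem_box_cart forall_3 h_def)
    then have "?B \<noteq> {}" by blast
    then show ?thesis
      by (simp add: content_cbox_cart prod_UNIV_3 h_def)
  qed
  finally show ?thesis .
qed

lemma frame_orthogonal_matrix:
  assumes "orthonormal_frame e"
  shows "orthogonal_matrix (\<chi> i. e i)"
  using assms
  by (auto simp: orthogonal_matrix_orthonormal_rows orthonormal_frame_def row_def
      orthogonal_def norm_eq_1 vec_lambda_eta)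

lemma frame_triple_product:
  assumes "orthonormal_frame e"
  shows "\<bar>e 1 \<bullet> (e 2 \<times> e 3)\<bar> = 1"
proof -
  have "(vector [e 1, e 2, e 3] :: real^3^3) = (\<chi> i. e i)"
    by (simp add: vec_eq_iff forall_3)
  then show ?thesis
    using det_orthogonal_matrix[OF frame_orthogonal_matrix[OF assms]]
    by (auto simp: dot_cross_det)
qed

text \<open>The box is a translated orthogonal image of a coordinate box, so no volume is lost.\<close>

lemma measure_frame_box_ge:
  assumes e: "orthonormal_frame e" and pos: "0 \<le> a" "0 \<le> b" "0 \<le> c"
    and E: "E \<in> lmeasurable" "frame_box z e a b c \<subseteq> E"
  shows "a * b * c \<le> measure lebesgue E"
proof -
  define M :: "real^3^3" where "M = (\<chi> i. e i)"
  define h :: "real^3" where "h = vector [a / 2, b / 2, c / 2]"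
  note transpose_matrix_vector[simp del]
  have M: "orthogonal_matrix M"
    unfolding M_def by (rule frame_orthogonal_matrix[OF e])
  have orth: "orthogonal_transformation ((*v) (transpose M))"
    using M orthogonal_matrix_transpose orthogonal_transformation_matrix by force
  have comp: "(transpose M *v y) \<bullet> e i = y $ i" for y i
  proof -
    have "(transpose M *v y) \<bullet> e i = (M *v (transpose M *v y)) $ i"
      by (simp add: M_def matrix_vector_mult_def inner_vec_def mult.commute)
    also have "\<dots> = y $ i"
      using M by (simp add: matrix_vector_mul_assoc orthogonal_matrix_def)
    finally show ?thesis .
  qed
  have "(+) z ` ((*v) (transpose M) ` cbox (- h) h) \<subseteq> frame_box z e a b c"
    by (auto simp: frame_box_def comp mem_box_cart forall_3 h_def abs_le_iff)
  then have "measure lebesgue ((+) z ` ((*v) (transpose M) ` cbox (- h) h)) \<le> measure lebesgue E"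
    using E by (intro measure_mono_fmeasurable)
      (auto intro!: fmeasurableD measurable_translation measurable_orthogonal_image orth)
  moreover have "measure lebesgue ((+) z ` ((*v) (transpose M) ` cbox (- h) h)) = measure lebesgue (cbox (- h) h)"
    by (simp only: measure_translation measure_orthogonal_image[OF orth] lmeasurable_cbox)
  moreover have "0 \<in> cbox (- h) h"
    using pos by (simp add: mem_box_cart forall_3 h_def)
  then have "cbox (- h) h \<noteq> {}" by blast
  then have "measure lebesgue (cbox (- h) h) = a * b * c"
    by (simp add: content_cbox_cart prod_UNIV_3 h_def)
  ultimately show ?thesis by linarith
qed

section \<open>Cauchy--Schwarz for a labelled family\<close>

text \<open>With \<open>f = \<Sum>\<^sub>i 1\<^bsub>Y i\<^esub>\<close>, the left-hand side is \<open>(\<integral>f)\<^sup>2\<close> and the double sum is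
  \<open>\<integral>f\<^sup>2\<close>. Since \<open>f\<close> vanishes off \<open>U\<close>, this is the Cauchy--Schwarz inequality for \<open>f\<close> and \<open>1\<^bsub>U\<^esub>\<close>,
  proved by integrating \<open>(f - t 1\<^bsub>U\<^esub>)\<^sup>2 \<ge> 0\<close> with the mean value \<open>t\<close> of \<open>f\<close> on \<open>U\<close>.\<close>

lemma sq_sum_measure_le:
  assumes "finite I" and Y: "\<And>i. i \<in> I \<Longrightarrow> Y i \<in> fmeasurable M"
  shows "(\<Sum>i\<in>I. measure M (Y i))\<^sup>2
    \<le> measure M (\<Union>i\<in>I. Y i) * (\<Sum>i\<in>I. \<Sum>j\<in>I. measure M (Y i \<inter> Y j))"
proof -
  define U where "U = (\<Union>i\<in>I. Y i)"
  define A where "A = (\<Sum>i\<in>I. measure M (Y i))"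
  define Q where "Q = (\<Sum>i\<in>I. \<Sum>j\<in>I. measure M (Y i \<inter> Y j))"
  define f where "f = (\<lambda>x. \<Sum>i\<in>I. indicat_real (Y i) x)"
  have U: "U \<in> fmeasurable M"
    unfolding U_def using assms by (intro fmeasurable.finite_UN) auto
  have ind: "has_bochner_integral M (indicat_real E) (measure M E)" if "E \<in> fmeasurable M" for E
    using that by (auto simp: fmeasurable_def intro!: has_bochner_integral_real_indicator)
  have int_f: "has_bochner_integral M f A"
    unfolding f_def A_def using Y by (intro has_bochner_integral_sum ind)
  have "has_bochner_integral M (\<lambda>x. \<Sum>i\<in>I. \<Sum>j\<in>I. indicat_real (Y i \<inter> Y j) x) Q"
    unfolding Q_def using Y by (intro has_bochner_integral_sum ind fmeasurable.Int)
  moreover have "(\<lambda>x. \<Sum>i\<in>I. \<Sum>j\<in>I. indicat_real (Y i \<inter> Y j) x) = (\<lambda>x. (f x)\<^sup>2)"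
    by (simp add: f_def power2_eq_square sum_product indicator_inter_arith)
  ultimately have int_sq: "has_bochner_integral M (\<lambda>x. (f x)\<^sup>2) Q" by simp
  have quad: "0 \<le> Q - 2 * t * A + t\<^sup>2 * measure M U" for t
  proof -
    have "has_bochner_integral M (\<lambda>x. (f x)\<^sup>2 - (2 * t) * f x + t\<^sup>2 * indicat_real U x)
        (Q - (2 * t) * A + t\<^sup>2 * measure M U)"
      using int_sq int_f ind[OF U]
      by (intro has_bochner_integral_add has_bochner_integral_diff has_bochner_integral_mult_right) auto
    moreover have "0 \<le> (f x)\<^sup>2 - (2 * t) * f x + t\<^sup>2 * indicat_real U x" for x
    proof (cases "x \<in> U")
      case True
      then have "(f x)\<^sup>2 - (2 * t) * f x + t\<^sup>2 * indicat_real U x = (f x - t)\<^sup>2"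
        by (simp add: power2_eq_square algebra_simps)
      then show ?thesis by simp
    next
      case False
      then have "f x = 0" by (auto simp: f_def U_def indicator_def)
      then show ?thesis by simp
    qed
    ultimately show ?thesis
      using Bochner_Integration.integral_nonneg by (metis (no_types, lifting) has_bochner_integral_integral_eq)
  qed
  have "A\<^sup>2 \<le> measure M U * Q"
  proof (cases "measure M U = 0")
    case True
    have "measure M (Y i) \<le> measure M U" if "i \<in> I" for i
      using that Y U by (intro measure_mono_fmeasurable) (auto simp: U_def)
    then have "A = 0"
      using True by (simp add: A_def measure_le_0_iff)
    then show ?thesis using True by simp
  next
    case False
    then have "measure M U > 0" by (simp add: zero_less_measure_iff)
    then show ?thesis
      using quad[of "A / measure M U"] by (simp add: field_simps power2_eq_square)
  qed
  then show ?thesis by (simp add: A_def Q_def U_def)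
qed

section \<open>Using the maximal density\<close>

text \<open>A real supremum dominates its members only when the set is bounded above; here the
  number of labels is a bound, because each member counted has at most the volume of \<open>K\<close>.\<close>

lemma sum_measure_le_Delta_max:
  assumes "finite I" and S: "\<And>i. i \<in> I \<Longrightarrow> S i \<in> lmeasurable"
    and K: "convex K" "K \<in> lmeasurable" "0 < measure lebesgue K"
  shows "(\<Sum>i | i \<in> I \<and> S i \<subseteq> K. measure lebesgue (S i)) \<le> Delta_max I S * measure lebesgue K"
proof -
  let ?q = "\<lambda>K. (\<Sum>i\<in>{i\<in>I. S i \<subseteq> K}. measure lebesgue (S i)) / measure lebesgue K"
  let ?A = "{K. convex K \<and> K \<in> lmeasurable \<and> 0 < measure lebesgue K}"
  have "?q K \<le> real (card I)" if "K \<in> ?A" for K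
  proof -
    have "(\<Sum>i\<in>{i\<in>I. S i \<subseteq> K}. measure lebesgue (S i))
        \<le> (\<Sum>i\<in>{i\<in>I. S i \<subseteq> K}. measure lebesgue K)"
      using that S by (intro sum_mono measure_mono_fmeasurable) auto
    also have "\<dots> \<le> real (card I) * measure lebesgue K"
      using \<open>finite I\<close> by (auto intro!: mult_right_mono card_mono)
    finally show ?thesis using that by (simp add: divide_le_eq)
  qed
  then have "bdd_above (?q ` ?A)"
    by (intro bdd_aboveI2)
  then have "?q K \<le> Delta_max I S"
    unfolding Delta_max_def using K by (intro cSUP_upper) auto
  then show ?thesis using K by (simp add: divide_le_eq)
qed

section \<open>Geometry of two slabs\<close>

text \<open>The third strip is taken along \<open>n \<times> m\<close>, the direction of the line in which the two
  middle planes meet, where only the ball limits the size of \<open>E\<close>. Leaving \<open>n \<times> m\<close> unnormalised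
  makes the triple product equal to \<open>norm (n \<times> m)\<^sup>2\<close> while the width costs one factor of it.\<close>

lemma slab_overlap:
  fixes n m :: "real^3"
  assumes E: "E \<in> lmeasurable" "E \<subseteq> cball p R"
    and n: "\<And>x. x \<in> E \<Longrightarrow> \<bar>(x - z) \<bullet> n\<bar> \<le> a / 2"
    and m: "\<And>x. x \<in> E \<Longrightarrow> \<bar>(x - z') \<bullet> m\<bar> \<le> a / 2"
    and "0 \<le> a" "0 \<le> R"
  shows "norm (n \<times> m) * measure lebesgue E \<le> 2 * a\<^sup>2 * R"
proof (cases "n \<times> m = 0")
  case False
  let ?s = "norm (n \<times> m)"
  have "\<bar>(x - p) \<bullet> (n \<times> m)\<bar> \<le> R * ?s" if "x \<in> E" for x
  proof -
    have "\<bar>(x - p) \<bullet> (n \<times> m)\<bar> \<le> norm (x - p) * ?s"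
      by (rule Cauchy_Schwarz_ineq2)
    also have "\<dots> \<le> R * ?s"
      using that E by (intro mult_right_mono) (auto simp: dist_norm norm_minus_commute)
    finally show ?thesis .
  qed
  then have "\<bar>(n \<times> m) \<bullet> (n \<times> m)\<bar> * measure lebesgue E \<le> 8 * (R * ?s) * (a / 2) * (a / 2)"
    using assms by (intro measure_three_strips[where p = p and q = z and r = z']) auto
  then have "?s * (?s * measure lebesgue E) \<le> ?s * (2 * a\<^sup>2 * R)"
    by (simp add: power2_norm_eq_inner[symmetric] power2_eq_square algebra_simps)
  then show ?thesis using False by simp
qed (use assms in simp)

text \<open>Split \<open>n\<close> into its component along \<open>m\<close>, which has length at most one, and the
  orthogonal remainder, whose length is exactly the sine \<open>norm (n \<times> m)\<close>. This treats \<open>m\<close> and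
  \<open>-m\<close> alike, so that no orientation of the normals has to be chosen.\<close>

lemma width_in_tilted_direction:
  fixes n m x y :: "real^3"
  assumes "norm n = 1" "norm m = 1" and xy: "\<bar>(x - y) \<bullet> m\<bar> \<le> a" "norm (x - y) \<le> d"
  shows "\<bar>(x - y) \<bullet> n\<bar> \<le> a + d * norm (n \<times> m)"
proof -
  let ?r = "n - (n \<bullet> m) *\<^sub>R m"
  have mm: "m \<bullet> m = 1" and nn: "n \<bullet> n = 1"
    using assms by (simp_all add: norm_eq_1)
  have "(norm ?r)\<^sup>2 = (norm (n \<times> m))\<^sup>2"
    using norm_cross_dot[of n m] assms mm nn
    by (simp add: power2_norm_eq_inner inner_diff_left inner_diff_right inner_commute)
       (simp add: power2_eq_square algebra_simps)
  then have r: "norm ?r = norm (n \<times> m)" by simp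
  have "\<bar>n \<bullet> m\<bar> \<le> 1"
    using Cauchy_Schwarz_ineq2[of n m] assms by simp
  then have 1: "\<bar>n \<bullet> m\<bar> * \<bar>(x - y) \<bullet> m\<bar> \<le> 1 * a"
    using xy by (intro mult_mono) auto
  have "\<bar>(x - y) \<bullet> ?r\<bar> \<le> norm (x - y) * norm ?r"
    by (rule Cauchy_Schwarz_ineq2)
  also have "\<dots> \<le> d * norm (n \<times> m)"
    unfolding r using xy by (intro mult_right_mono) auto
  finally have 2: "\<bar>(x - y) \<bullet> ?r\<bar> \<le> d * norm (n \<times> m)" .
  have "(x - y) \<bullet> n = (n \<bullet> m) * ((x - y) \<bullet> m) + (x - y) \<bullet> ?r"
    by (simp add: inner_diff_right)
  then have "\<bar>(x - y) \<bullet> n\<bar> \<le> \<bar>n \<bullet> m\<bar> * \<bar>(x - y) \<bullet> m\<bar> + \<bar>(x - y) \<bullet> ?r\<bar>"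
    by (metis abs_mult abs_triangle_ineq)
  then show ?thesis using 1 2 by simp
qed

lemma convex_slab_strip:
  assumes "convex_slab cJ a b c z e S" "x \<in> S"
  shows "\<bar>(x - z) \<bullet> e 1\<bar> \<le> a / 2" "\<bar>(x - z) \<bullet> e 2\<bar> \<le> b / 2" "\<bar>(x - z) \<bullet> e 3\<bar> \<le> c / 2"
  using assms by (auto simp: convex_slab_def frame_box_def)

lemma convex_slab_measure:
  assumes slab: "convex_slab cJ a b c z e S" and S: "S \<in> lmeasurable"
    and pos: "0 < cJ" "0 \<le> a" "0 \<le> b" "0 \<le> c"
  shows "cJ ^ 3 * (a * b * c) \<le> measure lebesgue S" "measure lebesgue S \<le> a * b * c"
proof -
  have e: "orthonormal_frame e" and d: "dilate z cJ (frame_box z e a b c) \<subseteq> S"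
    using slab by (auto simp: convex_slab_def)
  have "frame_box z e (cJ * a) (cJ * b) (cJ * c) \<subseteq> dilate z cJ (frame_box z e a b c)"
  proof
    fix x assume x: "x \<in> frame_box z e (cJ * a) (cJ * b) (cJ * c)"
    have "z + (1 / cJ) *\<^sub>R (x - z) \<in> frame_box z e a b c"
      using x pos by (auto simp: frame_box_def abs_mult divide_le_eq mult_ac)
    moreover have "x = z + cJ *\<^sub>R (z + (1 / cJ) *\<^sub>R (x - z) - z)"
      using pos by simp
    ultimately show "x \<in> dilate z cJ (frame_box z e a b c)"
      unfolding dilate_def by blast
  qed
  then have "(cJ * a) * (cJ * b) * (cJ * c) \<le> measure lebesgue S"
    using pos d by (intro measure_frame_box_ge[OF e _ _ _ S]) auto
  then show "cJ ^ 3 * (a * b * c) \<le> measure lebesgue S"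
    by (simp add: power3_eq_cube mult_ac)
  have "\<bar>e 1 \<bullet> (e 2 \<times> e 3)\<bar> * measure lebesgue S \<le> 8 * (a / 2) * (b / 2) * (c / 2)"
    using pos by (intro measure_three_strips[OF S, where p = z and q = z and r = z] convex_slab_strip[OF slab]) auto
  then show "measure lebesgue S \<le> a * b * c"
    by (simp add: frame_triple_product[OF e])
qed

text \<open>A point of \<open>S'\<close> is compared with a common point of \<open>S\<close> and \<open>S'\<close>: their difference
  contributes at most \<open>a + 2 t\<close> in the direction \<open>e 1\<close>, and the common point at most \<open>a / 2\<close>.\<close>

lemma slab_subset_plank:
  assumes i: "convex_slab cJ a b c z e S" and j: "convex_slab cJ' a b' c' z' e' S'"
    and ball: "S' \<subseteq> cball p R" and meet: "S \<inter> S' \<noteq> {}"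
    and s: "R * norm (e 1 \<times> e' 1) \<le> t" and "a \<le> t"
  shows "S' \<subseteq> {x \<in> cball p R. \<bar>(x - z) \<bullet> e 1\<bar> \<le> 4 * t}"
proof
  fix x assume x: "x \<in> S'"
  obtain y where y: "y \<in> S" "y \<in> S'" using meet by blast
  have unit: "norm (e 1) = 1" "norm (e' 1) = 1"
    using i j by (auto simp: convex_slab_def orthonormal_frame_def norm_eq_1)
  have "\<bar>(x - y) \<bullet> e' 1\<bar> \<le> a"
    using convex_slab_strip(1)[OF j x] convex_slab_strip(1)[OF j y(2)]
    unfolding inner_diff_left by linarith
  moreover have "norm (x - y) \<le> 2 * R"
  proof -
    have "dist p x \<le> R" "dist p y \<le> R" using x y ball by auto
    then show ?thesis using dist_triangle2[of x y p] by (simp add: dist_norm norm_minus_commute)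
  qed
  ultimately have "\<bar>(x - y) \<bullet> e 1\<bar> \<le> a + 2 * R * norm (e 1 \<times> e' 1)"
    by (rule width_in_tilted_direction[OF unit])
  then have "\<bar>(x - z) \<bullet> e 1\<bar> \<le> 4 * t"
    using convex_slab_strip(1)[OF i y(1)] s \<open>a \<le> t\<close>
    unfolding inner_diff_left by linarith
  then show "x \<in> {x \<in> cball p R. \<bar>(x - z) \<bullet> e 1\<bar> \<le> 4 * t}"
    using x ball by auto
qed

lemma measure_plank_le:
  assumes e: "orthonormal_frame e" and "0 \<le> t" "0 \<le> R"
    and K: "K = {x \<in> cball p R. \<bar>(x - z) \<bullet> e 1\<bar> \<le> 4 * t}"
  shows "convex K" "K \<in> lmeasurable" "measure lebesgue K \<le> 32 * R\<^sup>2 * t"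
proof -
  have "K = cball p R \<inter> ({x. e 1 \<bullet> x \<le> 4 * t + z \<bullet> e 1} \<inter> {x. e 1 \<bullet> x \<ge> z \<bullet> e 1 - 4 * t})"
    by (auto simp: K abs_le_iff inner_diff_left inner_commute[of "e 1"])
  then show conv: "convex K"
    by (simp add: convex_Int convex_halfspace_le convex_halfspace_ge)
  show Km: "K \<in> lmeasurable"
    by (rule measurable_convex[OF conv]) (auto simp: K intro: bounded_subset[OF bounded_cball])
  have coord: "\<bar>(x - p) \<bullet> e i\<bar> \<le> R" if "x \<in> K" for x i
  proof -
    have "\<bar>(x - p) \<bullet> e i\<bar> \<le> norm (x - p) * norm (e i)"
      by (rule Cauchy_Schwarz_ineq2)
    moreover have "norm (e i) = 1" using e by (simp add: orthonormal_frame_def norm_eq_1)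
    ultimately show ?thesis using that by (simp add: K dist_norm norm_minus_commute)
  qed
  have "\<bar>e 1 \<bullet> (e 2 \<times> e 3)\<bar> * measure lebesgue K \<le> 8 * (4 * t) * R * R"
    using assms by (intro measure_three_strips[OF Km, where p = z and q = p and r = p] coord) auto
  then show "measure lebesgue K \<le> 32 * R\<^sup>2 * t"
    by (simp add: frame_triple_product[OF e] power2_eq_square mult_ac)
qed

section \<open>Total overlap with one slab, and the union bound\<close>

text \<open>The sum over the angular scales described at the beginning. The smallest scale needs
  no angular gain: there \<open>|S j| \<le> a b c \<le> a R\<^sup>2\<close> already has the size of the bound for \<open>k = 0\<close>, so
  parallel and repeated slabs are covered too.\<close>

lemma overlap_sum_le:
  assumes "0 < cJ" "0 < a" "a \<le> b" "b \<le> c" "c \<le> R" and "finite I" "i \<in> I"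
    and slab: "\<And>j. j \<in> I \<Longrightarrow> convex_slab cJ a b c (z j) (e j) (S j)"
    and ball: "\<And>j. j \<in> I \<Longrightarrow> S j \<subseteq> cball p R"
  defines "D \<equiv> Delta_max I S" and "L \<equiv> real_of_int (1 + \<lceil>log 2 (R / a)\<rceil>)"
  shows "(\<Sum>j\<in>I. measure lebesgue (S i \<inter> S j))
    \<le> 128 / cJ ^ 3 * (a * b * c) * (L * D * R ^ 4 / (b\<^sup>2 * c\<^sup>2))"
proof -
  define N where "N = nat \<lceil>log 2 (R / a)\<rceil>"
  define s where "s = (\<lambda>j. norm (e i 1 \<times> e j 1))"
  define K where "K = (\<lambda>k. {x \<in> cball p R. \<bar>(x - z i) \<bullet> e i 1\<bar> \<le> 4 * (2 ^ k * a)})" for k :: nat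
  define J where "J = (\<lambda>k. {j \<in> I. S j \<subseteq> K k})"
  have R: "0 < R" "0 < b" "0 < c" "a \<le> R" using assms by auto
  have log_nonneg: "0 \<le> log 2 (R / a)"
    using R \<open>0 < a\<close> by simp
  then have L: "L = real (N + 1)"
    by (simp add: L_def N_def)
  have RN: "R \<le> 2 ^ N * a"
  proof -
    have "log 2 (R / a) \<le> real N"
      using log_nonneg by (simp add: N_def)
    then have "R / a \<le> 2 powr real N"
      using R \<open>0 < a\<close> by (simp add: log_le_iff)
    then show ?thesis
      using \<open>0 < a\<close> by (simp add: powr_realpow divide_le_eq)
  qed
  have frame: "orthonormal_frame (e j)" and unit: "norm (e j 1) = 1" if "j \<in> I" for j
    using slab[OF that] by (auto simp: convex_slab_def orthonormal_frame_def norm_eq_1)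
  have S: "S j \<in> lmeasurable" if "j \<in> I" for j
    using slab[OF that] ball[OF that]
    by (auto simp: convex_slab_def intro: measurable_convex bounded_subset[OF bounded_cball])
  have vol: "cJ ^ 3 * (a * b * c) \<le> measure lebesgue (S j)" "measure lebesgue (S j) \<le> a * b * c"
    if "j \<in> I" for j
    using convex_slab_measure[OF slab[OF that] S[OF that]] assms R by auto
  \<comment> \<open>The least admissible scale \<open>k\<close> serves both purposes: the sine is at most \<open>2\<^sup>k a / R\<close>,
      so \<open>S j\<close> lies in the plank \<open>K k\<close>, and for \<open>k > 0\<close> it exceeds \<open>2\<^sup>k\<^sup>-\<^sup>1 a / R\<close>, so the
      overlap is small. The scale \<open>N\<close> is always admissible because a sine is at most one.\<close>
  have pair: "\<exists>k\<le>N. j \<in> J k \<and> measure lebesgue (S i \<inter> S j) \<le> 4 * a * R\<^sup>2 / 2 ^ k"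
    if j: "j \<in> I" and meet: "S i \<inter> S j \<noteq> {}" for j
  proof -
    let ?m = "measure lebesgue (S i \<inter> S j)"
    have "(s j)\<^sup>2 \<le> 1"
      using norm_cross_dot[of "e i 1" "e j 1"] unit j \<open>i \<in> I\<close> by (simp add: s_def) (smt (verit) zero_le_power2)
    then have "s j \<le> 1"
      by (simp add: s_def abs_square_le_1)
    then have N: "R * s j \<le> 2 ^ N * a"
      using RN R mult_left_mono[of "s j" 1 R] by linarith
    define k where "k = (LEAST k. R * s j \<le> 2 ^ k * a)"
    have k: "R * s j \<le> 2 ^ k * a"
      unfolding k_def by (rule LeastI[of _ N]) (rule N)
    have "k \<le> N"
      unfolding k_def by (rule Least_le) (rule N)
    moreover have "j \<in> J k"
      using slab_subset_plank[OF slab[OF \<open>i \<in> I\<close>] slab[OF j] ball[OF j] meet k[unfolded s_def]] j \<open>0 < a\<close>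
      by (simp add: J_def K_def)
    moreover have "?m \<le> 4 * a * R\<^sup>2 / 2 ^ k"
    proof (cases k)
      case 0
      have "?m \<le> measure lebesgue (S j)"
        using S j \<open>i \<in> I\<close> by (intro measure_mono_fmeasurable) auto
      also have "\<dots> \<le> a * (b * c)" using vol[OF j] by (simp add: mult_ac)
      also have "\<dots> \<le> a * (R * R)" using assms R by (intro mult_left_mono mult_mono) auto
      also have "\<dots> \<le> 4 * (a * (R * R))" using R \<open>0 < a\<close> by simp
      finally show ?thesis by (simp add: 0 power2_eq_square mult_ac)
    next
      case (Suc k')
      have "\<not> R * s j \<le> 2 ^ k' * a"
        using not_less_Least[of k' "\<lambda>k. R * s j \<le> 2 ^ k * a"] Suc by (simp add: k_def)
      then have "(2 ^ k' * a) * ?m \<le> (R * s j) * ?m"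
        by (intro mult_right_mono) auto
      also have "\<dots> = R * (s j * ?m)" by simp
      also have "\<dots> \<le> R * (2 * a\<^sup>2 * R)"
        unfolding s_def
        using R \<open>0 < a\<close> ball[OF j] S[OF j] S[OF \<open>i \<in> I\<close>]
        by (intro mult_left_mono slab_overlap[where p = p and z = "z i" and z' = "z j"])
           (blast intro: convex_slab_strip(1)[OF slab[OF j]] convex_slab_strip(1)[OF slab[OF \<open>i \<in> I\<close>]] | force)+
      finally have "a * (2 ^ k' * ?m) \<le> a * (2 * a * R\<^sup>2)"
        by (simp add: power2_eq_square mult_ac)
      then show ?thesis using \<open>0 < a\<close> by (simp add: Suc field_simps)
    qed
    ultimately show ?thesis by blast
  qed
  have count: "real (card (J k)) * (cJ ^ 3 * (a * b * c)) \<le> D * (32 * R\<^sup>2 * (2 ^ k * a))" for k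
  proof -
    have t: "0 \<le> 2 ^ k * a" using \<open>0 < a\<close> by simp
    note K = measure_plank_le[OF frame[OF \<open>i \<in> I\<close>] t less_imp_le[OF \<open>0 < R\<close>] fun_cong[OF K_def]]
    \<comment> \<open>\<open>S i\<close> itself lies in every plank, which therefore has positive volume and is among
        the competitors in the supremum defining \<open>D\<close>.\<close>
    have "S i \<subseteq> K k"
    proof
      fix x assume x: "x \<in> S i"
      have "a / 2 \<le> 4 * (2 ^ k * a)"
        using \<open>0 < a\<close> mult_right_mono[of 1 "2 ^ k" a] one_le_power[of "2::real" k] by linarith
      then show "x \<in> K k"
        using convex_slab_strip(1)[OF slab[OF \<open>i \<in> I\<close>] x] x ball[OF \<open>i \<in> I\<close>] by (auto simp: K_def)
    qed
    then have "measure lebesgue (S i) \<le> measure lebesgue (K k)"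
      using S \<open>i \<in> I\<close> K by (intro measure_mono_fmeasurable) auto
    moreover have "0 < cJ ^ 3 * (a * b * c)" using assms R by simp
    ultimately have Kpos: "0 < measure lebesgue (K k)"
      using vol(1)[OF \<open>i \<in> I\<close>] by linarith
    have sum_le: "(\<Sum>j\<in>J k. measure lebesgue (S j)) \<le> D * measure lebesgue (K k)"
      unfolding D_def J_def by (rule sum_measure_le_Delta_max[OF \<open>finite I\<close> S K(1,2) Kpos])
    have "0 \<le> (\<Sum>j\<in>J k. measure lebesgue (S j))"
      by (intro sum_nonneg) auto
    then have "0 \<le> D"
      using sum_le Kpos by (smt (verit) mult_neg_pos)
    have "real (card (J k)) * (cJ ^ 3 * (a * b * c)) = (\<Sum>j\<in>J k. cJ ^ 3 * (a * b * c))"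
      by simp
    also have "\<dots> \<le> (\<Sum>j\<in>J k. measure lebesgue (S j))"
      by (intro sum_mono vol) (auto simp: J_def)
    also note sum_le
    also have "D * measure lebesgue (K k) \<le> D * (32 * R\<^sup>2 * (2 ^ k * a))"
      using K \<open>0 \<le> D\<close> by (intro mult_left_mono)
    finally show ?thesis .
  qed
  have "(\<Sum>j\<in>I. measure lebesgue (S i \<inter> S j))
      \<le> (\<Sum>j\<in>I. \<Sum>k\<le>N. if j \<in> J k then 4 * a * R\<^sup>2 / 2 ^ k else 0)"
  proof (rule sum_mono)
    fix j assume j: "j \<in> I"
    let ?f = "\<lambda>k. if j \<in> J k then 4 * a * R\<^sup>2 / 2 ^ k else 0"
    have nonneg: "0 \<le> ?f k" for k using R \<open>0 < a\<close> by simp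
    show "measure lebesgue (S i \<inter> S j) \<le> (\<Sum>k\<le>N. ?f k)"
    proof (cases "S i \<inter> S j = {}")
      case True
      have "0 \<le> (\<Sum>k\<le>N. ?f k)" by (intro sum_nonneg nonneg)
      then show ?thesis by (simp only: True measure_empty)
    next
      case False
      then obtain k where k: "k \<le> N" "j \<in> J k" "measure lebesgue (S i \<inter> S j) \<le> 4 * a * R\<^sup>2 / 2 ^ k"
        using pair[OF j] by blast
      then have "measure lebesgue (S i \<inter> S j) \<le> ?f k" by simp
      also have "\<dots> \<le> (\<Sum>k\<le>N. ?f k)"
        using k nonneg by (intro member_le_sum) auto
      finally show ?thesis .
    qed
  qed
  also have "\<dots> = (\<Sum>k\<le>N. \<Sum>j\<in>I. if j \<in> J k then 4 * a * R\<^sup>2 / 2 ^ k else 0)"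
    by (rule sum.swap)
  also have "\<dots> = (\<Sum>k\<le>N. real (card (J k)) * (4 * a * R\<^sup>2 / 2 ^ k))"
  proof (rule sum.cong[OF refl])
    fix k
    have "I \<inter> J k = J k" by (auto simp: J_def)
    then show "(\<Sum>j\<in>I. if j \<in> J k then 4 * a * R\<^sup>2 / 2 ^ k else 0) = real (card (J k)) * (4 * a * R\<^sup>2 / 2 ^ k)"
      using sum.inter_restrict[OF \<open>finite I\<close>, of "\<lambda>_. 4 * a * R\<^sup>2 / 2 ^ k" "J k"] by simp
  qed
  also have "\<dots> \<le> (\<Sum>k\<le>N. 128 / cJ ^ 3 * (a * b * c) * (D * R ^ 4 / (b\<^sup>2 * c\<^sup>2)))"
  proof (rule sum_mono)
    fix k
    define P :: real where "P = 2 ^ k"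
    have "0 < P" by (simp add: P_def)
    have v: "0 < cJ ^ 3 * (a * b * c)" using assms R by simp
    have "real (card (J k)) \<le> D * (32 * R\<^sup>2 * (P * a)) / (cJ ^ 3 * (a * b * c))"
      using count[of k] unfolding pos_le_divide_eq[OF v] P_def .
    then have "real (card (J k)) * (4 * a * R\<^sup>2 / P)
        \<le> D * (32 * R\<^sup>2 * (P * a)) / (cJ ^ 3 * (a * b * c)) * (4 * a * R\<^sup>2 / P)"
      using \<open>0 < a\<close> \<open>0 < P\<close> by (intro mult_right_mono) auto
    also have "\<dots> = 128 / cJ ^ 3 * (a * b * c) * (D * R ^ 4 / (b\<^sup>2 * c\<^sup>2))"
      using assms R \<open>0 < P\<close> by (simp add: field_simps power2_eq_square power3_eq_cube power4_eq_xxxx)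
    finally show "real (card (J k)) * (4 * a * R\<^sup>2 / 2 ^ k)
        \<le> 128 / cJ ^ 3 * (a * b * c) * (D * R ^ 4 / (b\<^sup>2 * c\<^sup>2))"
      by (simp add: P_def)
  qed
  also have "\<dots> = 128 / cJ ^ 3 * (a * b * c) * (L * D * R ^ 4 / (b\<^sup>2 * c\<^sup>2))"
    by (simp add: L)
  finally show ?thesis .
qed

text \<open>Here \<open>w = cJ\<^sup>3\<close> is the least proportion of its box that a slab fills, \<open>B\<close> is the total
  volume of the boxes, \<open>T\<close> that of the slabs, and \<open>Z\<close> the loss factor \<open>1 + L D R\<^sup>4 / (b\<^sup>2 c\<^sup>2)\<close>.
  One power of \<open>w\<close> in each constant is inherited from the energy bound; the others come from
  comparing \<open>T\<close> with \<open>w B\<close>, twice in the first bound and once in the second.\<close>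

lemma density_from_energy:
  fixes A B T u w Z :: real
  assumes "0 < w" "0 < B" and T: "w * B \<le> T" and "0 \<le> A" "1 \<le> Z" "0 \<le> u"
    and energy: "A\<^sup>2 \<le> u * (128 / w * B * Z)"
  shows "w ^ 3 / 128 * ((A / T)\<^sup>2 * B / Z) \<le> u"
    and "0 < A / T \<longrightarrow> A / u \<le> 128 / w\<^sup>2 * (inverse (A / T) * Z)"
proof -
  have wB: "0 < w * B" using assms by simp
  have "0 < T" "0 < Z" using wB assms by linarith+
  have "A / T \<le> A / (w * B)"
    using wB \<open>0 < T\<close> assms by (intro divide_left_mono mult_pos_pos) auto
  then have "(A / T)\<^sup>2 \<le> (A / (w * B))\<^sup>2"
    using \<open>0 < T\<close> \<open>0 \<le> A\<close> by (intro power_mono) auto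
  also have "\<dots> \<le> u * (128 / w * B * Z) / (w * B)\<^sup>2"
    unfolding power_divide by (intro divide_right_mono energy) auto
  finally have "w ^ 3 / 128 * ((A / T)\<^sup>2 * B / Z)
      \<le> w ^ 3 / 128 * (u * (128 / w * B * Z) / (w * B)\<^sup>2 * B / Z)"
    using assms \<open>0 < Z\<close> by (intro mult_left_mono divide_right_mono mult_right_mono) auto
  also have "\<dots> = u"
    using assms \<open>0 < Z\<close> by (simp add: field_simps power2_eq_square power3_eq_cube)
  finally show "w ^ 3 / 128 * ((A / T)\<^sup>2 * B / Z) \<le> u" .
  show "0 < A / T \<longrightarrow> A / u \<le> 128 / w\<^sup>2 * (inverse (A / T) * Z)"
  proof
    assume "0 < A / T"
    then have "0 < A" using \<open>0 < T\<close> by (simp add: zero_less_divide_iff)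
    then have "u \<noteq> 0" using energy by auto
    then have "0 < u" using \<open>0 \<le> u\<close> by simp
    have "128 / w * B * Z = 128 / w\<^sup>2 * (w * B) * Z"
      using \<open>0 < w\<close> by (simp add: power2_eq_square)
    also have "\<dots> \<le> 128 / w\<^sup>2 * T * Z"
      using T \<open>0 < Z\<close> by (intro mult_right_mono mult_left_mono) auto
    finally have "A\<^sup>2 \<le> u * (128 / w\<^sup>2 * T * Z)"
      using energy \<open>0 < u\<close> by (meson mult_left_mono order.trans less_imp_le)
    then have "A * A / (u * A) \<le> u * (128 / w\<^sup>2 * T * Z) / (u * A)"
      using \<open>0 < A\<close> \<open>0 < u\<close> by (intro divide_right_mono) (auto simp: power2_eq_square)
    then show "A / u \<le> 128 / w\<^sup>2 * (inverse (A / T) * Z)"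
      using \<open>0 < A\<close> \<open>0 < u\<close> \<open>0 < T\<close> by simp
  qed
qed

theorem theoremB3:
  fixes cJ :: real
  assumes "0 < cJ"
  shows "\<exists>\<kappa>>0. \<exists>C>0. \<forall>(a::real) (b::real) (c::real) (R::real) (p::real^3) (I::nat set)
      (S :: nat \<Rightarrow> (real^3) set) (z :: nat \<Rightarrow> real^3) (e :: nat \<Rightarrow> 3 \<Rightarrow> real^3)
      (Y :: nat \<Rightarrow> (real^3) set).
    0 < a \<and> a \<le> b \<and> b \<le> c \<and> c \<le> R \<and>
    finite I \<and> I \<noteq> {} \<and>
    (\<forall>i\<in>I. convex_slab cJ a b c (z i) (e i) (S i) \<and> S i \<subseteq> cball p R) \<and>
    (\<forall>i\<in>I. Y i \<in> sets lebesgue \<and> Y i \<subseteq> S i) \<longrightarrow>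
    (let D = Delta_max I S;
         L = real_of_int (1 + \<lceil>log 2 (R / a)\<rceil>);
         A = (\<Sum>i\<in>I. measure lebesgue (Y i));
         U = (\<Union>i\<in>I. Y i);
         lam = A / (\<Sum>i\<in>I. measure lebesgue (S i));
         \<mu> = A / measure lebesgue U
     in measure lebesgue U \<ge>
          \<kappa> * (lam^2 * real (card I) * (a * b * c) / (1 + L * D * R^4 / (b^2 * c^2))) \<and>
        (lam > 0 \<longrightarrow> \<mu> \<le> C * (inverse lam * (1 + L * D * R^4 / (b^2 * c^2)))))"
proof -
  define w where "w = cJ ^ 3"
  have w: "0 < w" using assms by (simp add: w_def)
  show ?thesis
  proof (rule exI[of _ "w ^ 3 / 128"], rule conjI;
      ((rule exI[of _ "128 / w\<^sup>2"], rule conjI)?; (intro allI impI)?))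
    show "0 < w ^ 3 / 128" "0 < 128 / w\<^sup>2" using w by simp_all
  next
    fix a b c R :: real and p :: "real^3" and I :: "nat set"
      and S Y :: "nat \<Rightarrow> (real^3) set" and z :: "nat \<Rightarrow> real^3" and e :: "nat \<Rightarrow> 3 \<Rightarrow> real^3"
    assume H: "0 < a \<and> a \<le> b \<and> b \<le> c \<and> c \<le> R \<and>
      finite I \<and> I \<noteq> {} \<and>
      (\<forall>i\<in>I. convex_slab cJ a b c (z i) (e i) (S i) \<and> S i \<subseteq> cball p R) \<and>
      (\<forall>i\<in>I. Y i \<in> sets lebesgue \<and> Y i \<subseteq> S i)"
    then have pos: "0 < a" "a \<le> b" "b \<le> c" "c \<le> R" "0 < b" "0 < c" and I: "finite I" "I \<noteq> {}"
      and slab: "\<And>i. i \<in> I \<Longrightarrow> convex_slab cJ a b c (z i) (e i) (S i)"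
      and ball: "\<And>i. i \<in> I \<Longrightarrow> S i \<subseteq> cball p R"
      and Y: "\<And>i. i \<in> I \<Longrightarrow> Y i \<in> sets lebesgue" "\<And>i. i \<in> I \<Longrightarrow> Y i \<subseteq> S i"
      by auto
    define A where "A = (\<Sum>i\<in>I. measure lebesgue (Y i))"
    define T where "T = (\<Sum>i\<in>I. measure lebesgue (S i))"
    define U where "U = (\<Union>i\<in>I. Y i)"
    define X where "X = real_of_int (1 + \<lceil>log 2 (R / a)\<rceil>) * Delta_max I S * R ^ 4 / (b\<^sup>2 * c\<^sup>2)"
    define B where "B = real (card I) * (a * b * c)"
    have B: "0 < B"
      using pos I by (simp add: B_def card_gt_0_iff)
    have S: "S i \<in> lmeasurable" if "i \<in> I" for i
      using slab[OF that] ball[OF that]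
      by (auto simp: convex_slab_def intro: measurable_convex bounded_subset[OF bounded_cball])
    have Ym: "Y i \<in> lmeasurable" if "i \<in> I" for i
      using fmeasurableI2[OF S Y(2) Y(1)] that by blast
    have overlap: "(\<Sum>j\<in>I. measure lebesgue (S i \<inter> S j)) \<le> 128 / w * (a * b * c) * X" if "i \<in> I" for i
      unfolding w_def X_def by (rule overlap_sum_le) (use assms pos I slab ball that in auto)
    have "0 \<le> X"
    proof -
      obtain i where "i \<in> I" using I by blast
      have "0 \<le> (\<Sum>j\<in>I. measure lebesgue (S i \<inter> S j))" by (intro sum_nonneg) auto
      also note overlap[OF \<open>i \<in> I\<close>]
      finally have "0 \<le> 128 / w * (a * b * c) * X" .
      moreover have "0 < 128 / w * (a * b * c)" using w pos by simp
      ultimately show ?thesis by (simp only: zero_le_mult_iff) linarith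
    qed
    have "A\<^sup>2 \<le> measure lebesgue U * (\<Sum>i\<in>I. \<Sum>j\<in>I. measure lebesgue (Y i \<inter> Y j))"
      unfolding A_def U_def by (rule sq_sum_measure_le[OF I(1) Ym])
    also have "\<dots> \<le> measure lebesgue U * (128 / w * B * (1 + X))"
    proof (rule mult_left_mono)
      have "(\<Sum>i\<in>I. \<Sum>j\<in>I. measure lebesgue (Y i \<inter> Y j))
          \<le> (\<Sum>i\<in>I. \<Sum>j\<in>I. measure lebesgue (S i \<inter> S j))"
        using S Ym Y(2) by (intro sum_mono measure_mono_fmeasurable) (blast intro: fmeasurableD fmeasurable.Int)+
      also have "\<dots> \<le> (\<Sum>i\<in>I. 128 / w * (a * b * c) * X)"
        by (intro sum_mono overlap)
      also have "\<dots> = 128 / w * B * X" by (simp add: B_def)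
      also have "\<dots> \<le> 128 / w * B * (1 + X)"
        using w B by (intro mult_left_mono) auto
      finally show "(\<Sum>i\<in>I. \<Sum>j\<in>I. measure lebesgue (Y i \<inter> Y j)) \<le> 128 / w * B * (1 + X)" .
    qed simp
    finally have energy: "A\<^sup>2 \<le> measure lebesgue U * (128 / w * B * (1 + X))" .
    have "w * B = (\<Sum>i\<in>I. cJ ^ 3 * (a * b * c))" by (simp add: B_def w_def)
    also have "\<dots> \<le> T"
      unfolding T_def using assms pos by (intro sum_mono convex_slab_measure(1)[OF slab S]) auto
    finally have T: "w * B \<le> T" .
    have "0 \<le> A" unfolding A_def by (intro sum_nonneg) auto
    from density_from_energy[OF w B T this _ _ energy] \<open>0 \<le> X\<close>
    have "w ^ 3 / 128 * ((A / T)\<^sup>2 * B / (1 + X)) \<le> measure lebesgue U"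
      and "0 < A / T \<longrightarrow> A / measure lebesgue U \<le> 128 / w\<^sup>2 * (inverse (A / T) * (1 + X))"
      by auto
    then show "let D = Delta_max I S;
         L = real_of_int (1 + \<lceil>log 2 (R / a)\<rceil>);
         A = (\<Sum>i\<in>I. measure lebesgue (Y i));
         U = (\<Union>i\<in>I. Y i);
         lam = A / (\<Sum>i\<in>I. measure lebesgue (S i));
         \<mu> = A / measure lebesgue U
     in measure lebesgue U \<ge>
          w ^ 3 / 128 * (lam^2 * real (card I) * (a * b * c) / (1 + L * D * R^4 / (b^2 * c^2))) \<and>
        (lam > 0 \<longrightarrow> \<mu> \<le> 128 / w\<^sup>2 * (inverse lam * (1 + L * D * R^4 / (b^2 * c^2))))"
      unfolding Let_def A_def T_def U_def X_def B_def by (simp only: mult.assoc simp_thms)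
  qed
qed

end
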